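(* (Second law for control operations.) In the setting and notation of the context, for every past record $\mathbf r_{n-1}$ with $P(\mathbf r_{n-1})>0$, the entropy production of the $n$-th control operation $$\Sigma^{\mathrm{ctrl}}(t_n,\mathbf r_n)=S(t_n^+,\mathbf r_n)-S(t_n^-,\mathbf r_{n-1})-\beta\,Q^{\mathrm{ctrl}}(t_n,\mathbf r_n)$$ satisfies $$\sum_{r_n}P(r_n|\mathbf r_{n-1})\,\Sigma^{\mathrm{ctrl}}(t_n,\mathbf r_n)\ge 0,$$ and therefore also $\sum_{\mathbf r_n}P(\mathbf r_n)\,\Sigma^{\mathrm{ctrl}}(t_n,\mathbf r_n)\ge 0$. (Sums run over outcomes of positive probability.)
   Context: Let $X$ (system states), $Y_1,\dots,Y_n$ (states of ancillas number $1,\dots,n$), $R_n$ (outcomes of the $n$-th measurement) and $\mathcal R_{n-1}$ (past measurement records) be finite non-empty sets. Write $\mathbf y_k=(y_k,\dots,y_1)$ with $y_j\in Y_j$, and $\mathbf r_n=(r_n,\mathbf r_{n-1})$ with $r_n\in R_n$, $\mathbf r_{n-1}\in\mathcal R_{n-1}$. Let $T>0$, $\beta=1/T$ (Boltzmann's constant is 1). Let $P(\mathbf r_{n-1})$ be a probability distribution on $\mathcal R_{n-1}$. For each $\mathbf r_{n-1}$ with $P(\mathbf r_{n-1})>0$ the following data are given (all may depend on $\mathbf r_{n-1}$): - vectors $\mathbf e=(e_x)_{x\in X}$ (internal energies) and $\mathbf s=(s_x)_{x\in X}$ (intrinsic entropies) in $\mathbb R^X$, evaluated at the value of the driving parameter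 at time $t_n$ (the control operation is instantaneous, so they are the same just before, $t_n^-$, and just after, $t_n^+$, the operation); - a joint probability distribution $p_{x,\mathbf y_n}(t_n^-,\mathbf r_{n-1})=p_{x,\mathbf y_{n-1}}(t_n^-,\mathbf r_{n-1})\,q_{y_n}$ of the system and all ancillas before the operation, where $\mathbf q=(q_y)_{y\in Y_n}$ is a probability vector (the initial state of the $n$-th ancilla, which is uncorrelated with the rest before the operation); - a permutation matrix $\Pi=(\Pi_{xy,x'y'})$ on $X\times Y_n$, and diagonal matrices $B(r_n)$, $r_n\in R_n$, on $\mathbb R^{Y_n}$ with non-negative entries summing to the identity, $\sum_{r_n}B(r_n)=\mathrm{id}$. The system marginal before the operation is $p_x(t_n^-,\mathbf r_{n-1})=\sum_{\mathbf y_n}p_{x,\mathbf y_n}(t_n^-,\mathbf r_{n-1})$. The control operation on the system is $A_{x,x'}(r_n|\mathbf r_{n-1})=\sum_{y,y'\in Y_n}B_{y,y}(r_n)\Pi_{xy,x'y'}q_{y'}$, with average $A_n=\sum_{r_n}A(r_n|\mathbf r_{n-1})$, a stochastic matrix. The joint state after the operation given outcome $r_n$, and the outcome probability, are defined by $$P(r_n|\mathbf r_{n-1})\,p_{x,\mathbf y_n}(t_n^+,\mathbf r_n)=\sum_{x'\in X,\,y_n'\in Y_n}B_{y_n,y_n}(r_n)\,\Pi_{xy_n,x'y_n'}\,p_{x',y_n'\mathbf y_{n-1}}(t_n^-,\mathbf r_{n-1}),$$ where $P(r_n|\mathbf r_{n-1})$ is the sum of the right-hand side over all $x,\mathbf y_n$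 (so $p_{x,\mathbf y_n}(t_n^+,\mathbf r_n)$ is a normalized distribution whenever $P(r_n|\mathbf r_{n-1})>0$). Set $P(\mathbf r_n)=P(r_n|\mathbf r_{n-1})P(\mathbf r_{n-1})$. The system marginal after the operation is $\mathbf p(t_n^+,\mathbf r_n)=A(r_n|\mathbf r_{n-1})\mathbf p(t_n^-,\mathbf r_{n-1})/P(r_n|\mathbf r_{n-1})$. $S_{\mathrm{Sh}}[\{p_a\}_a]=-\sum_a p_a\ln p_a$ (with $0\ln 0=0$) is the Shannon entropy. The stochastic entropies just before and after the operation are $$S(t_n^-,\mathbf r_{n-1})=S_{\mathrm{Sh}}[\{p_{x,\mathbf y_n}(t_n^-,\mathbf r_{n-1})\}_{x,\mathbf y_n}]+\mathbf s\cdot\mathbf p(t_n^-,\mathbf r_{n-1})-\ln P(\mathbf r_{n-1}),$$ $$S(t_n^+,\mathbf r_n)=S_{\mathrm{Sh}}[\{p_{x,\mathbf y_n}(t_n^+,\mathbf r_n)\}_{x,\mathbf y_n}]+\mathbf s\cdot\mathbf p(t_n^+,\mathbf r_n)-\ln P(\mathbf r_n).$$ The heat injected during the control operation is $$Q^{\mathrm{ctrl}}(t_n,\mathbf r_n)=\mathbf e\cdot\left[\frac{A(r_n|\mathbf r_{n-1})}{P(r_n|\mathbf r_{n-1})}-A_n\right]\mathbf p(t_n^-,\mathbf r_{n-1})+T\,\mathbf s\cdot(A_n-\mathrm{id})\,\mathbf p(t_n^-,\mathbf r_{n-1}).$$ *)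

theory Defs
  imports "HOL-Analysis.Analysis"
begin

text \<open>
  The state sets \<open>X\<close>, \<open>R\<^sub>n\<close> and the set of past records are finite types (type variables
  \<open>'x\<close>, \<open>'r\<close>, \<open>'h\<close>).  The ancilla state spaces may differ from each other, so they are a
  family \<open>Y\<close> of finite non-empty subsets of a common type; a tuple
  \<open>(y\<^sub>n, \<dots>, y\<^sub>1)\<close> is an element of \<open>PiE {1..n} Y\<close>.
\<close>

definition prob_vector :: "'a set \<Rightarrow> ('a \<Rightarrow> real) \<Rightarrow> bool" where
  "prob_vector A p \<longleftrightarrow> (\<forall>a\<in>A. 0 \<le> p a) \<and> (\<Sum>a\<in>A. p a) = 1"

text \<open>Since \<open>ln 0 = 0\<close>, the convention \<open>0 ln 0 = 0\<close> is automatic.\<close>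

definition shannon_entropy :: "'a set \<Rightarrow> ('a \<Rightarrow> real) \<Rightarrow> real" where
  "shannon_entropy A p = - (\<Sum>a\<in>A. p a * ln (p a))"

definition permutation_matrix :: "'a set \<Rightarrow> ('a \<Rightarrow> 'a \<Rightarrow> real) \<Rightarrow> bool" where
  "permutation_matrix I M \<longleftrightarrow>
     (\<exists>\<sigma>. \<sigma> permutes I \<and> (\<forall>i\<in>I. \<forall>j\<in>I. M i j = (if i = \<sigma> j then 1 else 0)))"

text \<open>
  The data attached to one past record.  \<open>joint_pre\<close> is the joint distribution of the system
  and all \<open>n\<close> ancillas just before the operation, \<open>ancilla\<close> is the vector \<open>q\<close>; the matrices
  \<open>\<Pi>\<close> and \<open>B(r)\<close> are given by their entries \<open>row column\<close>.
\<close>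

record ('x, 'y, 'r) control_data =
  energy :: "real ^ 'x"
  intrinsic_entropy :: "real ^ 'x"
  joint_pre :: "'x \<times> (nat \<Rightarrow> 'y) \<Rightarrow> real"
  ancilla :: "'y \<Rightarrow> real"
  Pi_mat :: "'x \<times> 'y \<Rightarrow> 'x \<times> 'y \<Rightarrow> real"
  B_mat :: "'r \<Rightarrow> 'y \<Rightarrow> 'y \<Rightarrow> real"

definition joint_states :: "nat \<Rightarrow> (nat \<Rightarrow> 'y set) \<Rightarrow> ('x \<times> (nat \<Rightarrow> 'y)) set" where
  "joint_states n Y = UNIV \<times> PiE {1..n} Y"

text \<open>
  In the third conjunct the inner sum is the marginal over the \<open>n\<close>-th ancilla, i.e. the
  distribution of the system and of the ancillas \<open>1, \<dots>, n - 1\<close>.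
\<close>

definition admissible ::
  "nat \<Rightarrow> (nat \<Rightarrow> 'y set) \<Rightarrow> ('x::finite, 'y, 'r::finite) control_data \<Rightarrow> bool" where
  "admissible n Y D \<longleftrightarrow>
     prob_vector (joint_states n Y) (joint_pre D) \<and>
     prob_vector (Y n) (ancilla D) \<and>
     (\<forall>(x, y) \<in> joint_states n Y.
        joint_pre D (x, y) = (\<Sum>v\<in>Y n. joint_pre D (x, y(n := v))) * ancilla D (y n)) \<and>
     permutation_matrix (UNIV \<times> Y n) (Pi_mat D) \<and>
     (\<forall>r. \<forall>y\<in>Y n. \<forall>y'\<in>Y n. y \<noteq> y' \<longrightarrow> B_mat D r y y' = 0) \<and>
     (\<forall>r. \<forall>y\<in>Y n. 0 \<le> B_mat D r y y) \<and>
     (\<forall>y\<in>Y n. \<forall>y'\<in>Y n. (\<Sum>r\<in>UNIV. B_mat D r y y') = (if y = y' then 1 else 0))"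

definition marginal ::
  "nat \<Rightarrow> (nat \<Rightarrow> 'y set) \<Rightarrow> ('x::finite \<times> (nat \<Rightarrow> 'y) \<Rightarrow> real) \<Rightarrow> real ^ 'x" where
  "marginal n Y p = (\<chi> x. \<Sum>y \<in> PiE {1..n} Y. p (x, y))"

definition control_op ::
  "nat \<Rightarrow> (nat \<Rightarrow> 'y set) \<Rightarrow> ('x::finite, 'y, 'r) control_data \<Rightarrow> 'r \<Rightarrow> real ^ 'x ^ 'x" where
  "control_op n Y D r =
     (\<chi> x x'. \<Sum>y\<in>Y n. \<Sum>y'\<in>Y n. B_mat D r y y * Pi_mat D (x, y) (x', y') * ancilla D y')"

definition avg_control_op ::
  "nat \<Rightarrow> (nat \<Rightarrow> 'y set) \<Rightarrow> ('x::finite, 'y, 'r::finite) control_data \<Rightarrow> real ^ 'x ^ 'x" where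
  "avg_control_op n Y D = (\<Sum>r\<in>UNIV. control_op n Y D r)"

definition unnormalized_post ::
  "nat \<Rightarrow> (nat \<Rightarrow> 'y set) \<Rightarrow> ('x::finite, 'y, 'r) control_data \<Rightarrow> 'r
     \<Rightarrow> 'x \<times> (nat \<Rightarrow> 'y) \<Rightarrow> real" where
  "unnormalized_post n Y D r = (\<lambda>(x, y).
     \<Sum>x'\<in>UNIV. \<Sum>v\<in>Y n.
       B_mat D r (y n) (y n) * Pi_mat D (x, y n) (x', v) * joint_pre D (x', y(n := v)))"

text \<open>The conditional probability of the outcome \<open>r\<close>, given the past record.\<close>

definition outcome_prob ::
  "nat \<Rightarrow> (nat \<Rightarrow> 'y set) \<Rightarrow> ('x::finite, 'y, 'r) control_data \<Rightarrow> 'r \<Rightarrow> real" where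
  "outcome_prob n Y D r = (\<Sum>z\<in>joint_states n Y. unnormalized_post n Y D r z)"

definition joint_post ::
  "nat \<Rightarrow> (nat \<Rightarrow> 'y set) \<Rightarrow> ('x::finite, 'y, 'r) control_data \<Rightarrow> 'r
     \<Rightarrow> 'x \<times> (nat \<Rightarrow> 'y) \<Rightarrow> real" where
  "joint_post n Y D r z = unnormalized_post n Y D r z / outcome_prob n Y D r"

text \<open>Below, \<open>P\<close> is the distribution of past records \<open>h\<close>, and \<open>D h\<close> is the data
  attached to \<open>h\<close>.\<close>

definition record_prob ::
  "nat \<Rightarrow> (nat \<Rightarrow> 'y set) \<Rightarrow> ('h \<Rightarrow> real) \<Rightarrow> ('h \<Rightarrow> ('x::finite, 'y, 'r) control_data)
     \<Rightarrow> 'r \<Rightarrow> 'h \<Rightarrow> real" where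
  "record_prob n Y P D r h = outcome_prob n Y (D h) r * P h"

definition entropy_pre ::
  "nat \<Rightarrow> (nat \<Rightarrow> 'y set) \<Rightarrow> ('h \<Rightarrow> real) \<Rightarrow> ('h \<Rightarrow> ('x::finite, 'y, 'r) control_data)
     \<Rightarrow> 'h \<Rightarrow> real" where
  "entropy_pre n Y P D h =
     shannon_entropy (joint_states n Y) (joint_pre (D h))
     + intrinsic_entropy (D h) \<bullet> marginal n Y (joint_pre (D h))
     - ln (P h)"

definition entropy_post ::
  "nat \<Rightarrow> (nat \<Rightarrow> 'y set) \<Rightarrow> ('h \<Rightarrow> real) \<Rightarrow> ('h \<Rightarrow> ('x::finite, 'y, 'r) control_data)
     \<Rightarrow> 'r \<Rightarrow> 'h \<Rightarrow> real" where
  "entropy_post n Y P D r h =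
     shannon_entropy (joint_states n Y) (joint_post n Y (D h) r)
     + intrinsic_entropy (D h) \<bullet> marginal n Y (joint_post n Y (D h) r)
     - ln (record_prob n Y P D r h)"

definition control_heat ::
  "nat \<Rightarrow> (nat \<Rightarrow> 'y set) \<Rightarrow> real \<Rightarrow> ('x::finite, 'y, 'r::finite) control_data
     \<Rightarrow> 'r \<Rightarrow> real" where
  "control_heat n Y T D r =
     energy D \<bullet>
       (((1 / outcome_prob n Y D r) *\<^sub>R control_op n Y D r - avg_control_op n Y D)
          *v marginal n Y (joint_pre D))
     + T * (intrinsic_entropy D \<bullet>
         ((avg_control_op n Y D - mat 1) *v marginal n Y (joint_pre D)))"

definition entropy_production ::
  "nat \<Rightarrow> (nat \<Rightarrow> 'y set) \<Rightarrow> real \<Rightarrow> ('h \<Rightarrow> real)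
     \<Rightarrow> ('h \<Rightarrow> ('x::finite, 'y, 'r::finite) control_data) \<Rightarrow> 'r \<Rightarrow> 'h \<Rightarrow> real" where
  "entropy_production n Y T P D r h =
     entropy_post n Y P D r h - entropy_pre n Y P D h - (1 / T) * control_heat n Y T (D h) r"

text \<open>
  The system marginal after the operation is taken to be the marginal of the joint state after
  the operation; it is the vector obtained by applying the control operation to the system
  marginal before it.
\<close>

lemma sum_PiE_last:
  fixes f :: "(nat \<Rightarrow> 'y) \<Rightarrow> real"
  assumes "1 \<le> n"
  shows "(\<Sum>y\<in>PiE {1..n} Y. f y) = (\<Sum>v\<in>Y n. \<Sum>w\<in>PiE {1..<n} Y. f (w(n := v)))"
proof -
  have I: "{1..n} = insert n {1..<n}" using assms by auto
  have inj: "inj_on (\<lambda>(v, w). w(n := v)) (Y n \<times> PiE {1..<n} Y)"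
    by (rule inj_combinator) simp
  show ?thesis
    unfolding I PiE_insert_eq
    by (subst sum.reindex[OF inj]) (simp add: sum.cartesian_product case_prod_unfold)
qed

lemma marginal_joint_post:
  fixes D :: "('a::finite, 'b, 'c::finite) control_data"
  assumes n: "1 \<le> n" and D: "admissible n Y D"
  shows "marginal n Y (joint_post n Y D r) =
         (1 / outcome_prob n Y D r) *\<^sub>R (control_op n Y D r *v marginal n Y (joint_pre D))"
proof -
  define m where "m x w = (\<Sum>v\<in>Y n. joint_pre D (x, w(n := v)))" for x w
  have fac: "joint_pre D (x, w(n := v)) = m x w * ancilla D v"
    if "w \<in> PiE {1..<n} Y" "v \<in> Y n" for x w v
  proof -
    have I: "{1..n} = insert n {1..<n}" using n by auto
    have "w(n := v) \<in> PiE {1..n} Y"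
      unfolding I by (rule PiE_fun_upd[OF that(2,1)])
    hence "(x, w(n := v)) \<in> joint_states n Y" by (simp add: joint_states_def)
    with D have "joint_pre D (x, w(n := v)) =
        (\<Sum>u\<in>Y n. joint_pre D (x, (w(n := v))(n := u))) * ancilla D ((w(n := v)) n)"
      unfolding admissible_def by (elim conjE) (drule (1) bspec, simp)
    thus ?thesis by (simp add: m_def)
  qed
  have pre: "marginal n Y (joint_pre D) $ x = (\<Sum>w\<in>PiE {1..<n} Y. m x w)" for x
    unfolding marginal_def sum_PiE_last[OF n] m_def vec_lambda_beta by (rule sum.swap)
  have swap3: "(\<Sum>w\<in>W. \<Sum>x'\<in>UNIV. \<Sum>v\<in>Y n. f w x' v) =
      (\<Sum>x'\<in>UNIV. \<Sum>v\<in>Y n. \<Sum>w\<in>W. f w x' v)"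
    for f :: "(nat \<Rightarrow> 'b) \<Rightarrow> 'a \<Rightarrow> 'b \<Rightarrow> real" and W
    by (rule trans[OF sum.swap]) (rule sum.cong[OF refl], rule sum.swap)
  have "(\<Sum>y\<in>PiE {1..n} Y. unnormalized_post n Y D r (x, y)) =
        (control_op n Y D r *v marginal n Y (joint_pre D)) $ x" for x
  proof -
    have "(\<Sum>y\<in>PiE {1..n} Y. unnormalized_post n Y D r (x, y)) =
      (\<Sum>u\<in>Y n. \<Sum>w\<in>PiE {1..<n} Y. \<Sum>x'\<in>UNIV. \<Sum>v\<in>Y n.
         B_mat D r u u * Pi_mat D (x, u) (x', v) * (m x' w * ancilla D v))"
      unfolding sum_PiE_last[OF n] unnormalized_post_def
      by (intro sum.cong refl) (simp add: fac)
    also have "\<dots> = (\<Sum>u\<in>Y n. \<Sum>x'\<in>UNIV. \<Sum>v\<in>Y n. \<Sum>w\<in>PiE {1..<n} Y.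
         B_mat D r u u * Pi_mat D (x, u) (x', v) * (m x' w * ancilla D v))"
      by (rule sum.cong[OF refl], rule swap3)
    also have "\<dots> = (\<Sum>x'\<in>UNIV. \<Sum>u\<in>Y n. \<Sum>v\<in>Y n. \<Sum>w\<in>PiE {1..<n} Y.
         B_mat D r u u * Pi_mat D (x, u) (x', v) * (m x' w * ancilla D v))"
      by (rule sum.swap)
    also have "\<dots> = (control_op n Y D r *v marginal n Y (joint_pre D)) $ x"
      unfolding matrix_vector_mult_def control_op_def vec_lambda_beta pre sum_distrib_right
      by (intro sum.cong refl) (simp add: sum_distrib_left, intro sum.cong refl, simp)
    finally show ?thesis .
  qed
  thus ?thesis
    by (simp add: vec_eq_iff marginal_def joint_post_def sum_divide_distrib[symmetric])
qed

end

theory Submission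
  imports Defs
begin

text \<open>
  On average over the outcomes, the energy part of the heat vanishes and its entropy part cancels
  the change of the intrinsic entropy.  The term \<open>- ln P(r)\<close> turns the averaged Shannon entropy
  of the states after the operation into the Shannon entropy of the joint distribution of the
  outcome and the final state.  The permutation matrix preserves the Shannon entropy, so the
  final state alone already carries the initial entropy, and adjoining the outcome cannot
  decrease it.
\<close>

section \<open>Logarithm, matrix and entropy preliminaries\<close>

lemma mult_ln_le_mult_ln:
  fixes u b :: real
  assumes "0 \<le> u" "u \<le> b"
  shows "u * ln u \<le> u * ln b"
  using assms by (cases "u = 0") (auto intro!: mult_left_mono)

lemma sum_matrix_vector_mult:
  fixes A :: "'i \<Rightarrow> real ^ 'n ^ 'm"
  shows "(\<Sum>i\<in>I. A i) *v x = (\<Sum>i\<in>I. A i *v x)"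
proof (induction I rule: infinite_finite_induct)
  case (insert i I)
  thus ?case by (simp add: matrix_vector_mult_add_rdistrib)
qed auto

text \<open>The entropy of a conditional state, weighted by its probability \<open>W\<close>, is
  expressed through the unnormalized weights. The correction \<open>W * ln W\<close> is what the
  term \<open>- ln P(r)\<close> of the stochastic entropy later removes.\<close>

lemma shannon_entropy_normalize:
  assumes "0 < W" "(\<Sum>a\<in>A. u a) = W" "\<And>a. a \<in> A \<Longrightarrow> 0 \<le> u a"
  shows "W * shannon_entropy A (\<lambda>a. u a / W) = W * ln W - (\<Sum>a\<in>A. u a * ln (u a))"
proof -
  have "W * (u a / W * ln (u a / W)) = u a * ln (u a) - u a * ln W" if "a \<in> A" for a
    using assms(1) assms(3)[OF that] by (cases "u a = 0") (auto simp: ln_div algebra_simps)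
  hence "W * shannon_entropy A (\<lambda>a. u a / W) = - (\<Sum>a\<in>A. u a * ln (u a) - u a * ln W)"
    unfolding shannon_entropy_def by (simp add: sum_distrib_left)
  also have "\<dots> = W * ln W - (\<Sum>a\<in>A. u a * ln (u a))"
    by (simp add: sum_subtractf sum_distrib_right[symmetric] assms(2))
  finally show ?thesis .
qed

section \<open>The joint state after the operation\<close>

lemma admissible_joint_pre_update:
  assumes "1 \<le> n" "admissible n Y D" "w \<in> PiE {1..<n} Y" "v \<in> Y n"
  shows "joint_pre D (x, w(n := v)) = (\<Sum>u\<in>Y n. joint_pre D (x, w(n := u))) * ancilla D v"
proof -
  have I: "{1..n} = insert n {1..<n}" using assms(1) by auto
  have "(x, w(n := v)) \<in> joint_states n Y"
    unfolding joint_states_def I using PiE_fun_upd[OF assms(4,3)] by simp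
  with assms(2) have "joint_pre D (x, w(n := v)) =
      (\<Sum>u\<in>Y n. joint_pre D (x, (w(n := v))(n := u))) * ancilla D ((w(n := v)) n)"
    unfolding admissible_def by (elim conjE) (drule (1) bspec, simp)
  thus ?thesis by simp
qed

text \<open>Each row of a permutation matrix has a single nonzero entry, so the double sum collapses
  to one value of \<open>joint_pre\<close>. The relabelling \<open>\<tau>\<close> is the same for
  all outcomes; the outcome enters only through the diagonal factor.\<close>

lemma unnormalized_post_permuted:
  fixes D :: "('x::finite, 'y, 'r::finite) control_data"
  assumes n: "1 \<le> n" and fin: "finite (Y n)" and D: "admissible n Y D"
  obtains \<tau> where "bij_betw \<tau> (joint_states n Y) (joint_states n Y)"
    and "\<And>r x y. (x, y) \<in> joint_states n Y \<Longrightarrow>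
      unnormalized_post n Y D r (x, y) = B_mat D r (y n) (y n) * joint_pre D (\<tau> (x, y))"
proof -
  have "permutation_matrix (UNIV \<times> Y n) (Pi_mat D)"
    using D by (simp add: admissible_def)
  then obtain \<sigma> where \<sigma>: "\<sigma> permutes (UNIV \<times> Y n)"
    and Pi: "\<And>i j. i \<in> UNIV \<times> Y n \<Longrightarrow> j \<in> UNIV \<times> Y n \<Longrightarrow>
      Pi_mat D i j = (if i = \<sigma> j then 1 else 0)"
    unfolding permutation_matrix_def by auto
  \<comment> \<open>\<open>act f\<close> lifts a map on the system and the last ancilla to all
    ancillas; the earlier ones stay fixed.\<close>
  define act :: "('x \<times> 'y \<Rightarrow> 'x \<times> 'y) \<Rightarrow> 'x \<times> (nat \<Rightarrow> 'y) \<Rightarrow> 'x \<times> (nat \<Rightarrow> 'y)" where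
    "act f z = (fst (f (fst z, snd z n)), (snd z)(n := snd (f (fst z, snd z n))))" for f z
  have act_joint: "act f ` joint_states n Y \<subseteq> joint_states n Y" if "f permutes UNIV \<times> Y n" for f
  proof (rule image_subsetI)
    fix z :: "'x \<times> (nat \<Rightarrow> 'y)" assume z: "z \<in> joint_states n Y"
    hence y: "snd z \<in> PiE {1..n} Y" by (auto simp: joint_states_def)
    hence "snd z n \<in> Y n" using n by (auto simp: PiE_iff)
    hence "f (fst z, snd z n) \<in> UNIV \<times> Y n" using permutes_in_image[OF that] by blast
    hence "snd (f (fst z, snd z n)) \<in> Y n" by (metis mem_Sigma_iff prod.collapse)
    with y n show "act f z \<in> joint_states n Y"
      by (auto simp: joint_states_def act_def PiE_iff extensional_def)
  qed
  have act_inverse: "act f (act g z) = z" if "\<And>p. f (g p) = p" for f g z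
    by (simp add: act_def that)
  have bij: "bij_betw (act (inv \<sigma>)) (joint_states n Y) (joint_states n Y)"
    using act_joint[OF \<sigma>] act_joint[OF permutes_inv[OF \<sigma>]]
    by (intro bij_betw_byWitness[where f' = "act \<sigma>"])
       (auto simp: act_inverse permutes_inverses[OF \<sigma>])
  have eq: "unnormalized_post n Y D r (x, y) =
      B_mat D r (y n) (y n) * joint_pre D (act (inv \<sigma>) (x, y))"
    if "(x, y) \<in> joint_states n Y" for r x y
  proof -
    let ?g = "\<lambda>p. B_mat D r (y n) (y n) * joint_pre D (fst p, y(n := snd p))"
    have xy: "(x, y n) \<in> UNIV \<times> Y n"
      using that n by (auto simp: joint_states_def PiE_iff)
    hence pre: "inv \<sigma> (x, y n) \<in> UNIV \<times> Y n"
      using permutes_in_image[OF permutes_inv[OF \<sigma>]] by blast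
    have "unnormalized_post n Y D r (x, y) =
        (\<Sum>p\<in>UNIV \<times> Y n. Pi_mat D (x, y n) p * ?g p)"
      unfolding unnormalized_post_def prod.case sum.cartesian_product
      by (simp add: case_prod_unfold mult_ac)
    \<comment> \<open>The entry in row \<open>i\<close> and column \<open>p\<close> is 1 iff
      \<open>i = \<sigma> p\<close>, that is, iff \<open>p\<close> is the preimage of
      \<open>i\<close>; hence the inverse of \<open>\<sigma>\<close>.\<close>
    also have "\<dots> = (\<Sum>p\<in>UNIV \<times> Y n. if inv \<sigma> (x, y n) = p then ?g p else 0)"
      using permutes_inverses[OF \<sigma>]
      by (intro sum.cong refl) (metis (mono_tags, lifting) Pi[OF xy] mult_1 mult_zero_left)
    also have "\<dots> = ?g (inv \<sigma> (x, y n))"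
      using pre fin by (simp add: sum.delta)
    finally show ?thesis by (simp add: act_def)
  qed
  show thesis using that[OF bij eq] by blast
qed

text \<open>The product form of the initial state lets the ancilla weight be absorbed into
  \<open>control_op\<close>. Without the division by the outcome probability, the identity stays
  informative for outcomes of probability zero.\<close>

lemma marginal_unnormalized_post:
  fixes D :: "('x::finite, 'y, 'r::finite) control_data"
  assumes n: "1 \<le> n" and D: "admissible n Y D"
  shows "marginal n Y (unnormalized_post n Y D r) =
    control_op n Y D r *v marginal n Y (joint_pre D)"
proof -
  let ?W = "PiE {1..<n} Y"
  let ?m = "\<lambda>x w. \<Sum>v\<in>Y n. joint_pre D (x, w(n := v))"
  have pre: "marginal n Y (joint_pre D) $ x = (\<Sum>w\<in>?W. ?m x w)" for x
    unfolding marginal_def sum_PiE_last[OF n] vec_lambda_beta by (rule sum.swap)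
  have "marginal n Y (unnormalized_post n Y D r) $ x =
      (control_op n Y D r *v marginal n Y (joint_pre D)) $ x" for x
  proof -
    let ?c = "\<lambda>u x' v. B_mat D r u u * Pi_mat D (x, u) (x', v) * ancilla D v"
    have "marginal n Y (unnormalized_post n Y D r) $ x =
        (\<Sum>u\<in>Y n. \<Sum>w\<in>?W. \<Sum>x'\<in>UNIV. \<Sum>v\<in>Y n. ?c u x' v * ?m x' w)"
      unfolding marginal_def sum_PiE_last[OF n] unnormalized_post_def vec_lambda_beta prod.case
      by (intro sum.cong refl, subst fun_upd_same, subst fun_upd_upd,
          subst admissible_joint_pre_update[OF n D]) (simp_all add: mult_ac)
    also have "\<dots> = (\<Sum>u\<in>Y n. \<Sum>x'\<in>UNIV. \<Sum>v\<in>Y n. ?c u x' v * (\<Sum>w\<in>?W. ?m x' w))"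
      unfolding sum_distrib_left[of _ _ ?W]
      by (rule sum.cong[OF refl], rule trans[OF sum.swap], rule sum.cong[OF refl], rule sum.swap)
    also have "\<dots> = (\<Sum>x'\<in>UNIV. (\<Sum>u\<in>Y n. \<Sum>v\<in>Y n. ?c u x' v) * (\<Sum>w\<in>?W. ?m x' w))"
      unfolding sum_distrib_right by (rule sum.swap)
    also have "\<dots> = (control_op n Y D r *v marginal n Y (joint_pre D)) $ x"
      by (simp add: matrix_vector_mult_def control_op_def pre)
    finally show ?thesis .
  qed
  thus ?thesis by (simp add: vec_eq_iff)
qed

section \<open>Entropy production for one outcome and on average\<close>

text \<open>Weighting by the outcome probability clears the denominators in the final state and in
  the heat. The terms in \<open>ln (P h)\<close> and in the initial intrinsic entropy cancel; what
  remains of the energy and the intrinsic entropy is linear in \<open>A - W A_avg\<close>, which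
  sums to zero over the outcomes.\<close>

lemma outcome_weighted_entropy_production:
  fixes D :: "'h \<Rightarrow> ('x::finite, 'y, 'r::finite) control_data"
  assumes n: "1 \<le> n" and D: "admissible n Y (D h)" and T: "0 < T" and P: "0 < P h"
    and W: "0 < outcome_prob n Y (D h) r"
    and u: "\<And>z. z \<in> joint_states n Y \<Longrightarrow> 0 \<le> unnormalized_post n Y (D h) r z"
  defines "A \<equiv> control_op n Y (D h) r *v marginal n Y (joint_pre (D h))"
    and "A_avg \<equiv> avg_control_op n Y (D h) *v marginal n Y (joint_pre (D h))"
  shows "outcome_prob n Y (D h) r * entropy_production n Y T P D r h =
    - (\<Sum>z\<in>joint_states n Y. unnormalized_post n Y (D h) r z * ln (unnormalized_post n Y (D h) r z))
    - outcome_prob n Y (D h) r * shannon_entropy (joint_states n Y) (joint_pre (D h))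
    + intrinsic_entropy (D h) \<bullet> (A - outcome_prob n Y (D h) r *\<^sub>R A_avg)
    - (1 / T) * (energy (D h) \<bullet> (A - outcome_prob n Y (D h) r *\<^sub>R A_avg))"
proof -
  let ?W = "outcome_prob n Y (D h) r" and ?s = "intrinsic_entropy (D h)" and ?e = "energy (D h)"
  let ?J = "joint_states n Y" and ?v = "marginal n Y (joint_pre (D h))"
  let ?u = "unnormalized_post n Y (D h) r"
  have S: "?W * shannon_entropy ?J (joint_post n Y (D h) r) =
      ?W * ln ?W - (\<Sum>z\<in>?J. ?u z * ln (?u z))"
    unfolding joint_post_def
    by (intro shannon_entropy_normalize W u) (simp_all add: outcome_prob_def)
  have "?s \<bullet> marginal n Y (joint_post n Y (D h) r) = (?s \<bullet> A) / ?W"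
    by (simp add: marginal_joint_post[OF n D] A_def)
  \<comment> \<open>The logarithm of \<open>record_prob\<close> splits into
    \<open>ln ?W + ln (P h)\<close>, and its first part cancels the \<open>?W * ln ?W\<close> in
    \<open>S\<close>.\<close>
  hence post: "?W * entropy_post n Y P D r h =
      - (\<Sum>z\<in>?J. ?u z * ln (?u z)) + ?s \<bullet> A - ?W * ln (P h)"
    using W P S by (simp add: entropy_post_def record_prob_def ln_mult algebra_simps)
  have "control_heat n Y T (D h) r =
      (?e \<bullet> A) / ?W - ?e \<bullet> A_avg + T * (?s \<bullet> A_avg - ?s \<bullet> ?v)"
    unfolding control_heat_def A_def A_avg_def
    by (simp add: matrix_vector_mult_diff_rdistrib scaleR_matrix_vector_assoc[symmetric]
        inner_diff_right)
  hence heat: "?W * ((1 / T) * control_heat n Y T (D h) r) =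
      (1 / T) * (?e \<bullet> A - ?W * (?e \<bullet> A_avg)) + ?W * (?s \<bullet> A_avg - ?s \<bullet> ?v)"
    using W T by (simp add: field_simps)
  have "?W * entropy_production n Y T P D r h = ?W * entropy_post n Y P D r h
      - ?W * entropy_pre n Y P D h - ?W * ((1 / T) * control_heat n Y T (D h) r)"
    unfolding entropy_production_def by (simp only: right_diff_distrib)
  also have "\<dots> = - (\<Sum>z\<in>?J. ?u z * ln (?u z)) - ?W * shannon_entropy ?J (joint_pre (D h))
      + (?s \<bullet> A - ?W * (?s \<bullet> A_avg)) - (1 / T) * (?e \<bullet> A - ?W * (?e \<bullet> A_avg))"
    unfolding post heat entropy_pre_def by (simp add: algebra_simps)
  finally show ?thesis by (simp add: inner_diff_right)
qed

lemma mean_entropy_production_nonneg: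
  fixes D :: "'h \<Rightarrow> ('x::finite, 'y, 'r::finite) control_data"
  assumes n: "1 \<le> n" and fin: "\<And>j. j \<in> {1..n} \<Longrightarrow> finite (Y j)"
    and D: "admissible n Y (D h)" and T: "0 < T" and P: "0 < P h"
  shows "0 \<le> (\<Sum>r | 0 < outcome_prob n Y (D h) r.
    outcome_prob n Y (D h) r * entropy_production n Y T P D r h)"
proof -
  let ?W = "outcome_prob n Y (D h)" and ?u = "unnormalized_post n Y (D h)"
  let ?J = "joint_states n Y :: ('x \<times> (nat \<Rightarrow> 'y)) set" and ?p = "joint_pre (D h)"
  let ?H = "shannon_entropy ?J ?p"
  \<comment> \<open>Sums over \<open>R\<close> are extended below to all outcomes, where the
    matrices \<open>B_mat\<close> sum to the identity.\<close>
  define R where "R = {r. 0 < ?W r}"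
  define A where "A r = control_op n Y (D h) r *v marginal n Y ?p" for r
  define A_avg where "A_avg = avg_control_op n Y (D h) *v marginal n Y ?p"
  have finJ: "finite ?J"
    unfolding joint_states_def using fin by (auto intro!: finite_PiE)
  have last: "snd z n \<in> Y n" if "z \<in> ?J" for z
    using that n by (auto simp: joint_states_def PiE_iff)
  have p: "0 \<le> ?p z" if "z \<in> ?J" for z
    using D that by (auto simp: admissible_def prob_vector_def)
  have p1: "(\<Sum>z\<in>?J. ?p z) = 1"
    using D by (simp add: admissible_def prob_vector_def)
  have B: "0 \<le> B_mat (D h) r y y" "(\<Sum>r\<in>UNIV. B_mat (D h) r y y) = 1" if "y \<in> Y n" for r y
    using D that by (auto simp: admissible_def)
  obtain \<tau> where bij: "bij_betw \<tau> ?J ?J" and u_eq: "\<And>r x y. (x, y) \<in> ?J \<Longrightarrow>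
      ?u r (x, y) = B_mat (D h) r (y n) (y n) * ?p (\<tau> (x, y))"
    using unnormalized_post_permuted[OF n _ D] fin n by (metis atLeastAtMost_iff order_refl)
  have u: "?u r z = B_mat (D h) r (snd z n) (snd z n) * ?p (\<tau> z)" if "z \<in> ?J" for r z
    using u_eq[of "fst z" "snd z"] that by simp
  have \<tau>: "\<tau> z \<in> ?J" if "z \<in> ?J" for z
    using bij that by (auto simp: bij_betw_def)
  have u0: "0 \<le> ?u r z" if "z \<in> ?J" for r z
    using B(1)[OF last[OF that]] p[OF \<tau>[OF that]] that by (simp add: u)
  \<comment> \<open>Forgetting the outcome leaves exactly the permuted initial state.\<close>
  have usum: "(\<Sum>r\<in>UNIV. ?u r z) = ?p (\<tau> z)" if "z \<in> ?J" for z
    using that by (simp add: u sum_distrib_right[symmetric] B(2)[OF last])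
  have W0: "0 \<le> ?W r" for r
    unfolding outcome_prob_def by (intro sum_nonneg u0)
  have out: "?u r z = 0" if "r \<notin> R" "z \<in> ?J" for r z
  proof -
    have "(\<Sum>z\<in>?J. ?u r z) = 0"
      using that(1) W0[of r] by (simp add: R_def outcome_prob_def)
    thus ?thesis using sum_nonneg_eq_0_iff[OF finJ, of "?u r"] u0 that(2) by auto
  qed
  \<comment> \<open>Polymorphic in the value type: it is applied to real sums and to the vectors
    \<open>A r\<close>.\<close>
  have extend: "(\<Sum>r\<in>R. f r) = (\<Sum>r\<in>UNIV. f r)"
    if "\<And>r. r \<notin> R \<Longrightarrow> f r = 0" for f :: "'r \<Rightarrow> 'b::comm_monoid_add"
    using that by (intro sum.mono_neutral_left) auto
  have "(\<Sum>r\<in>R. ?W r) = (\<Sum>r\<in>UNIV. ?W r)"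
    using W0 by (intro extend) (simp add: R_def order.antisym not_less)
  also have "\<dots> = (\<Sum>z\<in>?J. \<Sum>r\<in>UNIV. ?u r z)"
    unfolding outcome_prob_def by (rule sum.swap)
  also have "\<dots> = (\<Sum>z\<in>?J. ?p (\<tau> z))" by (simp add: usum)
  also have "\<dots> = 1" using sum.reindex_bij_betw[OF bij, of ?p] p1 by simp
  finally have W1: "(\<Sum>r\<in>R. ?W r) = 1" .
  have "A r = 0" if "r \<notin> R" for r
  proof -
    have "marginal n Y (?u r) = 0"
      unfolding marginal_def vec_eq_iff vec_lambda_beta zero_index
      by (intro allI sum.neutral ballI out[OF that]) (simp add: joint_states_def)
    thus ?thesis by (simp add: A_def marginal_unnormalized_post[OF n D])
  qed
  hence "(\<Sum>r\<in>R. A r) = (\<Sum>r\<in>UNIV. A r)" by (rule extend)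
  hence A1: "(\<Sum>r\<in>R. A r) = A_avg"
    by (simp add: A_def A_avg_def avg_control_op_def sum_matrix_vector_mult)
  have drift: "(\<Sum>r\<in>R. c \<bullet> (A r - ?W r *\<^sub>R A_avg)) = 0" for c
    by (simp add: inner_sum_right[symmetric] sum_subtractf scaleR_sum_left[symmetric] A1 W1)
  have "(\<Sum>r\<in>R. ?W r * entropy_production n Y T P D r h) =
      (\<Sum>r\<in>R. - (\<Sum>z\<in>?J. ?u r z * ln (?u r z)) - ?W r * ?H
        + intrinsic_entropy (D h) \<bullet> (A r - ?W r *\<^sub>R A_avg)
        - (1 / T) * (energy (D h) \<bullet> (A r - ?W r *\<^sub>R A_avg)))"
    unfolding A_def A_avg_def
    by (intro sum.cong refl outcome_weighted_entropy_production n D T P u0) (simp_all add: R_def)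
  also have "\<dots> = - (\<Sum>r\<in>R. \<Sum>z\<in>?J. ?u r z * ln (?u r z)) - ?H"
    by (simp only: sum_subtractf sum.distrib sum_negf drift sum_distrib_left[symmetric]
        sum_distrib_right[symmetric] W1)
  also have "(\<Sum>r\<in>R. \<Sum>z\<in>?J. ?u r z * ln (?u r z)) =
      (\<Sum>r\<in>UNIV. \<Sum>z\<in>?J. ?u r z * ln (?u r z))"
    by (intro extend sum.neutral ballI) (simp add: out)
  \<comment> \<open>The double sum with its sign is the Shannon entropy of the pair of outcome and
    final state.\<close>
  finally have mean: "(\<Sum>r\<in>R. ?W r * entropy_production n Y T P D r h) =
      - (\<Sum>r\<in>UNIV. \<Sum>z\<in>?J. ?u r z * ln (?u r z)) - ?H" .
  have "(\<Sum>r\<in>UNIV. \<Sum>z\<in>?J. ?u r z * ln (?u r z)) =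
      (\<Sum>z\<in>?J. \<Sum>r\<in>UNIV. ?u r z * ln (?u r z))"
    by (rule sum.swap)
  \<comment> \<open>Each weight is at most its sum over the outcomes, which by \<open>usum\<close>
    is \<open>?p (\<tau> z)\<close>; monotonicity of \<open>ln\<close> then gives the only
    inequality between entropies.\<close>
  also have "\<dots> \<le> (\<Sum>z\<in>?J. \<Sum>r\<in>UNIV. ?u r z * ln (?p (\<tau> z)))"
    using u0 by (intro sum_mono mult_ln_le_mult_ln)
      (auto simp: usum[symmetric] intro!: member_le_sum)
  also have "\<dots> = (\<Sum>z\<in>?J. ?p (\<tau> z) * ln (?p (\<tau> z)))"
    by (simp add: sum_distrib_right[symmetric] usum)
  \<comment> \<open>Entropy is invariant under the relabelling \<open>\<tau>\<close>.\<close>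
  also have "\<dots> = - ?H"
    using sum.reindex_bij_betw[OF bij, of "\<lambda>z. ?p z * ln (?p z)"]
    by (simp add: shannon_entropy_def)
  finally show ?thesis using mean by (simp add: R_def)
qed

theorem mainTheorem2:
  fixes n :: nat
    and Y :: "nat \<Rightarrow> 'y set"
    and T :: real
    and P :: "'h::finite \<Rightarrow> real"
    and D :: "'h \<Rightarrow> ('x::finite, 'y, 'r::finite) control_data"
  assumes "1 \<le> n"
    and "\<And>j. j \<in> {1..n} \<Longrightarrow> finite (Y j) \<and> Y j \<noteq> {}"
    and "0 < T"
    and "prob_vector UNIV P"
    and "\<And>h. 0 < P h \<Longrightarrow> admissible n Y (D h)"
  shows "(\<forall>h. 0 < P h \<longrightarrow>
            0 \<le> (\<Sum>r | 0 < outcome_prob n Y (D h) r.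
                   outcome_prob n Y (D h) r * entropy_production n Y T P D r h))
         \<and> 0 \<le> (\<Sum>(r, h) | 0 < record_prob n Y P D r h.
                   record_prob n Y P D r h * entropy_production n Y T P D r h)"
proof (intro conjI allI impI)
  have mean: "0 \<le> (\<Sum>r | 0 < outcome_prob n Y (D h) r.
      outcome_prob n Y (D h) r * entropy_production n Y T P D r h)" if "0 < P h" for h
    using assms that by (intro mean_entropy_production_nonneg) auto
  thus "0 \<le> (\<Sum>r | 0 < outcome_prob n Y (D h) r.
      outcome_prob n Y (D h) r * entropy_production n Y T P D r h)" if "0 < P h" for h
    using that .
  have P: "0 \<le> P h" for h
    using assms(4) by (simp add: prob_vector_def)
  \<comment> \<open>Nonnegativity of \<open>P h\<close> excludes a positive product of two negative
    factors, about whose data \<open>D h\<close> nothing is assumed.\<close>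
  hence pos: "0 < record_prob n Y P D r h \<longleftrightarrow> 0 < P h \<and> 0 < outcome_prob n Y (D h) r" for r h
    using P[of h] by (auto simp: record_prob_def zero_less_mult_iff not_less[symmetric])
  have "(\<Sum>(r, h) | 0 < record_prob n Y P D r h.
        record_prob n Y P D r h * entropy_production n Y T P D r h) =
      (\<Sum>(h, r)\<in>(SIGMA h:{h. 0 < P h}. {r. 0 < outcome_prob n Y (D h) r}).
        record_prob n Y P D r h * entropy_production n Y T P D r h)"
    \<comment> \<open>Swapping the pairs puts the record outside, so that \<open>P h\<close> can be
      pulled out of the inner sum and \<open>mean\<close> applies to each record.\<close>
    by (rule sum.reindex_bij_witness[where i = prod.swap and j = prod.swap]) (auto simp: pos)
  also have "\<dots> = (\<Sum>h | 0 < P h. P h * (\<Sum>r | 0 < outcome_prob n Y (D h) r.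
      outcome_prob n Y (D h) r * entropy_production n Y T P D r h))"
    by (subst sum.Sigma[symmetric]) (auto simp: record_prob_def sum_distrib_left mult_ac)
  also have "0 \<le> \<dots>"
    by (intro sum_nonneg mult_nonneg_nonneg P mean) simp
  finally show "0 \<le> (\<Sum>(r, h) | 0 < record_prob n Y P D r h.
      record_prob n Y P D r h * entropy_production n Y T P D r h)" .
qed

end
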